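(* Let $a,b$ be nonnegative integers with $a+b\ge 1$, and let $\mu$ be a positive real number with $a\ge\mu b$. Consider all $\binom{a+b}{a}$ sequences consisting of $a$ votes for candidate $A$ and $b$ votes for candidate $B$, each equally likely. For a sequence and $1\le r\le a+b$, let $a_r$ and $b_r$ be the numbers of votes for $A$ and $B$ among its first $r$ votes. Call a sequence cute if $a_r\ge \mu b_r$ for all $1\le r\le a+b$. Let $P^*$ be the probability that a uniformly random such sequence is cute. Then $$\frac{\lfloor a-\mu b+1\rfloor}{a+b}\;\le\; P^*\;\le\;\frac{a+1-\mu b}{a+1}.$$
   Context: $\lfloor x\rfloor$ denotes the greatest integer not exceeding $x$. Note $a_r+b_r=r$.
   Formalization: The lower bound is asserted only for b ≥ 1: when b = 0 the single sequence is cute, so P* = 1, while the stated lower bound would be (a+1)/a > 1; the upper bound is proved in full. *)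

theory Defs
  imports "HOL-Probability.Probability"
begin

datatype vote = VoteA | VoteB

definition ballots :: "nat \<Rightarrow> nat \<Rightarrow> vote list set" where
  "ballots a b = {xs. count_list xs VoteA = a \<and> count_list xs VoteB = b}"

definition cute :: "real \<Rightarrow> vote list \<Rightarrow> bool" where
  "cute \<mu> xs \<longleftrightarrow> (\<forall>r\<in>{1..length xs}.
     real (count_list (take r xs) VoteA) \<ge> \<mu> * real (count_list (take r xs) VoteB))"

definition cute_prob :: "real \<Rightarrow> nat \<Rightarrow> nat \<Rightarrow> real" where
  "cute_prob \<mu> a b = measure_pmf.prob (pmf_of_set (ballots a b)) {xs. cute \<mu> xs}"

lemma length_ballots:
  assumes "xs \<in> ballots a b"
  shows "length xs = a + b"
proof -
  have "length ys = count_list ys VoteA + count_list ys VoteB" for ys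
  proof (induction ys)
    case (Cons y ys)
    then show ?case by (cases y) auto
  qed simp
  with assms show ?thesis by (simp add: ballots_def)
qed

text \<open>The function \<^const>\<open>pmf_of_set\<close> is meaningful only for finite nonempty sets, which
  the next two facts establish.\<close>

lemma finite_ballots: "finite (ballots a b)"
proof (rule finite_subset)
  have "x \<in> {VoteA, VoteB}" for x
    by (cases x) simp_all
  then have "set xs \<subseteq> {VoteA, VoteB}" for xs
    by blast
  then show "ballots a b \<subseteq> {xs. set xs \<subseteq> {VoteA, VoteB} \<and> length xs = a + b}"
    using length_ballots by blast
  show "finite {xs. set xs \<subseteq> {VoteA, VoteB} \<and> length xs = a + b}"
    by (rule finite_lists_length_eq) simp
qed

lemma ballots_nonempty: "ballots a b \<noteq> {}"
proof -
  have "count_list (replicate n x) y = (if x = y then n else 0)" for n and x y :: vote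
    by (induction n) auto
  then have "replicate a VoteA @ replicate b VoteB \<in> ballots a b"
    by (simp add: ballots_def)
  then show ?thesis by blast
qed

end

theory Submission
  imports Defs
begin

text \<open>
  Lower bound: weight each vote for \<open>A\<close> by \<open>1\<close> and each vote for \<open>B\<close> by \<open>- \<mu>\<close>, and let \<open>p\<close> be the
  partial sums of the periodic extension of a ballot sequence. The rotation starting at \<open>i\<close> is
  cute if \<open>p i\<close> equals the future minimum \<open>m i\<close> of \<open>p\<close>. Over one period \<open>m\<close> grows by \<open>a - \<mu> b\<close>; it
  grows only at such positions, and by at most \<open>1\<close> each time. Equality throughout would force all
  late positions to be of this kind, which a vote for \<open>B\<close> prevents, so more than \<open>a - \<mu> b\<close> of the
  \<open>a + b\<close> rotations are cute. Averaging over all ballot sequences gives the bound.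

  Upper bound: \<open>(a + 1 - \<mu> b) / (a + 1)\<close> times the number of ballot sequences equals
  \<open>(a + b choose a) - \<mu> (a + b choose (a + 1))\<close>. This satisfies Pascal's recurrence and is
  nonnegative on the points with \<open>\<mu> b \<le> a + 1\<close>, so it dominates the number of cute
  sequences, which satisfies the same recurrence and vanishes for \<open>a < \<mu> b\<close>.
\<close>

section \<open>A cycle lemma for real weights\<close>

text \<open>The strict inequality, which comes from \<open>neg\<close>, is what later allows
  \<open>floor (x + 1)\<close> in place of the ceiling of \<open>x\<close>.\<close>

lemma cycle_lemma_real:
  fixes w p :: "nat \<Rightarrow> real" and n :: nat
  defines "p \<equiv> \<lambda>j. \<Sum>l<j. w l"
  assumes periodic: "\<And>i. w (i + n) = w i"
    and w_le_1: "\<And>i. w i \<le> 1"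
    and total_nonneg: "0 \<le> p n"
    and neg: "w k < 0"
    and n_pos: "0 < n"
  shows "p n < real (card {i. i < n \<and> (\<forall>j\<ge>i. p i \<le> p j)})"
proof -
  have p_Suc: "p (Suc j) = p j + w j" for j
    by (simp add: p_def)
  have p_shift: "p (j + n) = p j + p n" for j
  proof (induction j)
    case 0
    show ?case by (simp add: p_def)
  next
    case (Suc j)
    then show ?case using p_Suc[of "j + n"] p_Suc[of j] periodic[of j] by simp
  qed
  \<comment> \<open>Since \<open>p\<close> does not decrease under a shift by \<open>n\<close>, a
    window of one period already realizes the minimum over all later positions.\<close>
  define m where "m i = Min (p ` {i..i + n})" for i
  have m_le: "m i \<le> p j" if "i \<le> j" for i j
    using that
  proof (induction j rule: less_induct)
    case (less j)
    show ?case
    proof (cases "j \<le> i + n")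
      case True
      then show ?thesis using less.prems by (auto simp: m_def intro!: Min_le)
    next
      case False
      then have "m i \<le> p (j - n)" using less n_pos by auto
      also have "\<dots> \<le> p j" using p_shift[of "j - n"] False total_nonneg by simp
      finally show ?thesis .
    qed
  qed
  have m_attained: "\<exists>j\<ge>i. m i = p j" for i
  proof -
    have "m i \<in> p ` {i..i + n}" unfolding m_def by (rule Min_in) auto
    then show ?thesis by auto
  qed
  define good where "good i \<longleftrightarrow> (\<forall>j\<ge>i. p i \<le> p j)" for i
  have m_good: "m i = p i" if "good i" for i
    using that m_attained[of i] m_le[of i i] by (fastforce simp: good_def)
  have goodI: "good i" if "p i \<le> m i" for i
    using that m_le order_trans by (force simp: good_def)
  have m_shift: "m (i + n) = m i + p n" for i
  proof (rule antisym)
    obtain j where "j \<ge> i" "m i = p j" using m_attained by blast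
    then show "m (i + n) \<le> m i + p n" using m_le[of "i + n" "j + n"] p_shift[of j] by simp
    obtain j where "j \<ge> i + n" "m (i + n) = p j" using m_attained by blast
    then show "m i + p n \<le> m (i + n)" using m_le[of i "j - n"] p_shift[of "j - n"] by simp
  qed
  \<comment> \<open>At a good \<open>i\<close>,
    \<open>m (Suc i) \<le> p (Suc i) \<le> p i + 1 = m i + 1\<close>. Otherwise the minimum is
    attained strictly after \<open>i\<close>, so \<open>m\<close> cannot grow.\<close>
  have jump: "m (Suc i) - m i \<le> of_bool (good i)" for i
  proof (cases "good i")
    case True
    then show ?thesis using m_good[of i] m_le[of "Suc i" "Suc i"] p_Suc[of i] w_le_1[of i] by simp
  next
    case False
    obtain j where j: "j \<ge> i" "m i = p j" using m_attained by blast
    have "j \<noteq> i" using False goodI[of i] j by auto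
    then show ?thesis using j m_le[of "Suc i" j] False by simp
  qed
  have sum_jumps: "(\<Sum>i<n. m (Suc i) - m i) = p n"
    using m_shift[of 0] by (simp add: sum_lessThan_telescope)
  have card_eq: "(\<Sum>i<n. of_bool (good i)) = real (card {i. i < n \<and> good i})"
    by (simp add: of_bool_def sum.If_cases Int_def)
  have "p n \<noteq> real (card {i. i < n \<and> good i})"
  proof
    assume "p n = real (card {i. i < n \<and> good i})"
    then have "(\<Sum>i<n. of_bool (good i) - (m (Suc i) - m i)) = 0"
      using sum_jumps card_eq by (simp only: sum_subtractf)
    then have eq_lt: "m (Suc i) - m i = of_bool (good i)" if "i < n" for i
      using that jump by (subst (asm) sum_nonneg_eq_0_iff) auto
    have good_shift: "good (i + n) \<longleftrightarrow> good i" for i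
    proof -
      have good_iff: "good l \<longleftrightarrow> m l = p l" for l
        using m_good goodI by (metis order_refl)
      show ?thesis unfolding good_iff m_shift p_shift by simp
    qed
    \<comment> \<open>Periodicity carries the equality from the first period to all
      positions.\<close>
    have eq: "m (Suc i) - m i = of_bool (good i)" for i
    proof (induction i rule: less_induct)
      case (less i)
      show ?case
      proof (cases "i < n")
        case False
        then have "m (Suc (i - n)) - m (i - n) = of_bool (good (i - n))"
          using less n_pos by simp
        then show ?thesis
          using m_shift[of "i - n"] m_shift[of "Suc (i - n)"] good_shift[of "i - n"] False by simp
      qed (rule eq_lt)
    qed
    \<comment> \<open>A jump of exactly 1 gives \<open>m (Suc i) = p i + 1 \<ge> p (Suc i)\<close>,
      so goodness propagates forward.\<close>
    have good_Suc: "good (Suc i)" if "good i" for i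
      using that eq[of i] m_good[of i] p_Suc[of i] w_le_1[of i] by (intro goodI) simp
    obtain j where j: "m 0 = p j" using m_attained by blast
    then have "good j" using m_le[of 0] by (simp add: good_def)
    then have good_add: "good (j + i)" for i
      by (induction i) (auto intro: good_Suc)
    have w_mult: "w (k + i * n) = w k" for i
    proof (induction i)
      case (Suc i)
      then show ?case using periodic[of "k + i * n"] by (simp add: algebra_simps)
    qed simp
    \<comment> \<open>A copy of \<open>k\<close> lies beyond the good position \<open>j\<close>,
      hence is good, although \<open>p\<close> drops there.\<close>
    have "j \<le> k + j * n" using n_pos by (simp add: trans_le_add2)
    then have "good (k + j * n)" using good_add[of "k + j * n - j"] by simp
    then have "p (k + j * n) \<le> p (Suc (k + j * n))" by (simp add: good_def)
    then show False using p_Suc[of "k + j * n"] w_mult[of j] neg by simp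
  qed
  moreover have "p n \<le> real (card {i. i < n \<and> good i})"
    unfolding sum_jumps[symmetric] card_eq[symmetric] by (intro sum_mono jump)
  ultimately show ?thesis by (simp add: good_def)
qed

section \<open>The lower bound\<close>

definition vote_weight :: "real \<Rightarrow> vote \<Rightarrow> real" where
  "vote_weight \<mu> v = (case v of VoteA \<Rightarrow> 1 | VoteB \<Rightarrow> - \<mu>)"

lemma sum_vote_weight_take:
  assumes "r \<le> length xs"
  shows "(\<Sum>l<r. vote_weight \<mu> (xs ! l)) =
    real (count_list (take r xs) VoteA) - \<mu> * real (count_list (take r xs) VoteB)"
  using assms
proof (induction r)
  case (Suc r)
  then show ?case
    by (cases "xs ! r") (simp_all add: take_Suc_conv_app_nth vote_weight_def algebra_simps)
qed simp

lemma card_cute_rotations: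
  assumes xs: "xs \<in> ballots a b" and "b \<ge> 1" and "\<mu> > 0" and le: "\<mu> * real b \<le> real a"
  shows "real a - \<mu> * real b < real (card {i. i < a + b \<and> cute \<mu> (rotate i xs)})"
proof -
  define n where "n = a + b"
  have len: "length xs = n" using length_ballots[OF xs] by (simp add: n_def)
  have n_pos: "0 < n" using \<open>b \<ge> 1\<close> by (simp add: n_def)
  define w where "w i = vote_weight \<mu> (xs ! (i mod n))" for i
  define p where "p j = (\<Sum>l<j. w l)" for j
  have "p n = (\<Sum>l<n. vote_weight \<mu> (xs ! l))"
    unfolding p_def w_def by (intro sum.cong) auto
  also have "\<dots> = real a - \<mu> * real b"
    using sum_vote_weight_take[of n xs \<mu>] len xs by (simp add: ballots_def)
  finally have p_n: "p n = real a - \<mu> * real b" .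
  have "VoteB \<in> set xs" using xs \<open>b \<ge> 1\<close> count_list_0_iff[of xs VoteB] by (auto simp: ballots_def)
  then obtain k where k: "k < n" "xs ! k = VoteB" using len by (auto simp: in_set_conv_nth)
  have "(\<Sum>l<n. w l) < real (card {i. i < n \<and> (\<forall>j\<ge>i. (\<Sum>l<i. w l) \<le> (\<Sum>l<j. w l))})"
  proof (rule cycle_lemma_real[where k = k])
    show "w i \<le> 1" for i
      using \<open>\<mu> > 0\<close> by (simp add: w_def vote_weight_def split: vote.split)
    show "w k < 0" using k \<open>\<mu> > 0\<close> by (simp add: w_def vote_weight_def)
    show "0 \<le> (\<Sum>l<n. w l)" using p_n le by (simp add: p_def)
  qed (simp_all add: w_def n_pos)
  then have "p n < real (card {i. i < n \<and> (\<forall>j\<ge>i. p i \<le> p j)})"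
    by (simp add: p_def)
  \<comment> \<open>Only an inclusion: a good position bounds the whole future, while cuteness looks
    at the next \<open>n\<close> votes, whose partial sums are
    \<open>p (i + r) - p i\<close>.\<close>
  also have "\<dots> \<le> real (card {i. i < n \<and> cute \<mu> (rotate i xs)})"
  proof (intro of_nat_mono card_mono subsetI)
    fix i assume "i \<in> {i. i < n \<and> (\<forall>j\<ge>i. p i \<le> p j)}"
    then have i: "i < n" "\<And>j. j \<ge> i \<Longrightarrow> p i \<le> p j" by auto
    have "cute \<mu> (rotate i xs)"
      unfolding cute_def
    proof
      fix r assume "r \<in> {1..length (rotate i xs)}"
      then have r: "r \<le> n" by (simp add: len)
      have "p (i + r) = p i + (\<Sum>l<r. w (i + l))"
        unfolding p_def by (induction r) simp_all
      also have "(\<Sum>l<r. w (i + l)) = (\<Sum>l<r. vote_weight \<mu> (rotate i xs ! l))"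
        using r by (intro sum.cong) (simp_all add: w_def nth_rotate len)
      finally show "\<mu> * real (count_list (take r (rotate i xs)) VoteB)
          \<le> real (count_list (take r (rotate i xs)) VoteA)"
        using i(2)[of "i + r"] sum_vote_weight_take[of r "rotate i xs" \<mu>] r by (simp add: len)
    qed
    with i show "i \<in> {i. i < n \<and> cute \<mu> (rotate i xs)}" by simp
  qed simp
  finally show ?thesis unfolding p_n by (simp add: n_def)
qed

lemma count_list_rotate: "count_list (rotate i xs) x = count_list xs x"
proof (induction i)
  case (Suc i)
  have "count_list (rotate1 ys) x = count_list ys x" for ys
    by (cases ys) auto
  with Suc show ?case by simp
qed simp

lemma bij_betw_rotate_ballots: "bij_betw (rotate i) (ballots a b) (ballots a b)"
proof -
  have inj: "inj_on (rotate i) (ballots a b)"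
    using inj_fn[OF inj_rotate1, of i] unfolding rotate_def by (rule inj_on_subset) simp
  moreover have "rotate i ` ballots a b \<subseteq> ballots a b"
    by (auto simp: ballots_def count_list_rotate)
  ultimately show ?thesis
    using endo_inj_surj[OF finite_ballots] by (simp add: bij_betw_def)
qed

lemma cute_prob_eq:
  "cute_prob \<mu> a b = real (card {xs \<in> ballots a b. cute \<mu> xs}) / real (card (ballots a b))"
  by (simp add: cute_prob_def measure_pmf_of_set[OF ballots_nonempty finite_ballots] Int_def)

lemma cute_prob_lower:
  assumes "b \<ge> 1" and "\<mu> > 0" and "\<mu> * real b \<le> real a"
  shows "real_of_int \<lfloor>real a - \<mu> * real b + 1\<rfloor> / real (a + b) \<le> cute_prob \<mu> a b"
proof -
  let ?k = "\<lfloor>real a - \<mu> * real b + 1\<rfloor>"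
  let ?C = "{xs \<in> ballots a b. cute \<mu> xs}"
  have k_le: "real_of_int ?k \<le> real (card {i. i < a + b \<and> cute \<mu> (rotate i xs)})"
    if "xs \<in> ballots a b" for xs
  proof -
    \<comment> \<open>An integer strictly above \<open>a - \<mu> b\<close> is at least
      \<open>?k\<close>.\<close>
    have "?k < int (card {i. i < a + b \<and> cute \<mu> (rotate i xs)}) + 1"
      unfolding floor_less_iff using card_cute_rotations[OF that assms] by simp
    then show ?thesis by linarith
  qed
  \<comment> \<open>Double counting of pairs of a ballot sequence and a cute rotation: each fixed
    rotation permutes the ballot sequences, so every \<open>i\<close> contributes
    \<open>card ?C\<close>.\<close>
  have "real (card (ballots a b)) * real_of_int ?k
      \<le> (\<Sum>xs\<in>ballots a b. real (card {i. i < a + b \<and> cute \<mu> (rotate i xs)}))"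
    by (rule sum_bounded_below) (rule k_le)
  also have "\<dots> = (\<Sum>xs\<in>ballots a b. \<Sum>i<a + b. of_bool (cute \<mu> (rotate i xs)))"
    by (simp add: of_bool_def sum.If_cases Int_def)
  also have "\<dots> = (\<Sum>i<a + b. \<Sum>xs\<in>ballots a b. of_bool (cute \<mu> (rotate i xs)))"
    by (rule sum.swap)
  also have "\<dots> = (\<Sum>i<a + b. \<Sum>xs\<in>ballots a b. of_bool (cute \<mu> xs))"
    by (intro sum.cong refl sum.reindex_bij_betw bij_betw_rotate_ballots)
  also have "\<dots> = real (a + b) * real (card ?C)"
    using finite_ballots by (simp add: of_bool_def sum.If_cases Int_def)
  finally have "real (card (ballots a b)) * real_of_int ?k \<le> real (a + b) * real (card ?C)" .
  moreover have "card (ballots a b) > 0"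
    using finite_ballots ballots_nonempty by (simp add: card_gt_0_iff)
  ultimately show ?thesis
    using \<open>b \<ge> 1\<close> by (simp add: cute_prob_eq field_simps)
qed

section \<open>The upper bound\<close>

lemma ballots_0_right: "ballots a 0 = {replicate a VoteA}"
proof -
  have "xs = replicate a VoteA" if "xs \<in> ballots a 0" for xs
  proof (rule replicate_eqI)
    show "length xs = a" using length_ballots[OF that] by simp
    show "y = VoteA" if "y \<in> set xs" for y
    proof -
      have "VoteB \<notin> set xs"
        using \<open>xs \<in> ballots a 0\<close> by (simp add: ballots_def count_list_0_iff)
      with that show ?thesis using vote.exhaust[of y] by metis
    qed
  qed
  then show ?thesis using ballots_nonempty[of a 0] by blast
qed

lemma ballots_0_left: "ballots 0 b = {replicate b VoteB}"
proof -
  have "xs = replicate b VoteB" if "xs \<in> ballots 0 b" for xs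
  proof (rule replicate_eqI)
    show "length xs = b" using length_ballots[OF that] by simp
    show "y = VoteB" if "y \<in> set xs" for y
    proof -
      have "VoteA \<notin> set xs"
        using \<open>xs \<in> ballots 0 b\<close> by (simp add: ballots_def count_list_0_iff)
      with that show ?thesis using vote.exhaust[of y] by metis
    qed
  qed
  then show ?thesis using ballots_nonempty[of 0 b] by blast
qed

lemma ballots_Suc_Suc:
  "ballots (Suc a) (Suc b) =
    (\<lambda>xs. xs @ [VoteA]) ` ballots a (Suc b) \<union> (\<lambda>xs. xs @ [VoteB]) ` ballots (Suc a) b"
proof -
  have "xs \<in> (\<lambda>xs. xs @ [VoteA]) ` ballots a (Suc b) \<union> (\<lambda>xs. xs @ [VoteB]) ` ballots (Suc a) b"
    if "xs \<in> ballots (Suc a) (Suc b)" for xs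
  proof (cases xs rule: rev_cases)
    case (snoc ys y)
    with that show ?thesis by (cases y) (auto simp: ballots_def)
  qed (use that in \<open>simp add: ballots_def\<close>)
  then show ?thesis by (auto simp: ballots_def)
qed

lemma card_ballots: "card (ballots a b) = (a + b) choose a"
proof (induction a arbitrary: b)
  case 0
  show ?case by (simp add: ballots_0_left)
next
  case (Suc a)
  show ?case
  proof (induction b)
    case 0
    show ?case by (simp add: ballots_0_right)
  next
    case (Suc b)
    have "card (ballots (Suc a) (Suc b)) = card (ballots a (Suc b)) + card (ballots (Suc a) b)"
      unfolding ballots_Suc_Suc
      by (subst card_Un_disjoint) (auto simp: finite_ballots card_image inj_on_def)
    with Suc \<open>\<And>b. card (ballots a b) = (a + b) choose a\<close> show ?case by simp
  qed
qed

lemma cute_append: "cute \<mu> (xs @ ys) \<Longrightarrow> cute \<mu> xs"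
  by (force simp: cute_def dest: bspec)

text \<open>Deleting the last vote preserves cuteness.\<close>

lemma card_cute_Suc_Suc_le:
  "card {xs \<in> ballots (Suc a) (Suc b). cute \<mu> xs}
    \<le> card {xs \<in> ballots a (Suc b). cute \<mu> xs} + card {xs \<in> ballots (Suc a) b. cute \<mu> xs}"
    (is "_ \<le> card ?A + card ?B")
proof -
  have "{xs \<in> ballots (Suc a) (Suc b). cute \<mu> xs}
      \<subseteq> (\<lambda>xs. xs @ [VoteA]) ` ?A \<union> (\<lambda>xs. xs @ [VoteB]) ` ?B"
    unfolding ballots_Suc_Suc by (auto dest: cute_append)
  then have "card {xs \<in> ballots (Suc a) (Suc b). cute \<mu> xs}
      \<le> card ((\<lambda>xs. xs @ [VoteA]) ` ?A \<union> (\<lambda>xs. xs @ [VoteB]) ` ?B)"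
    by (intro card_mono) (simp_all add: finite_ballots)
  also have "\<dots> \<le> card ((\<lambda>xs. xs @ [VoteA]) ` ?A) + card ((\<lambda>xs. xs @ [VoteB]) ` ?B)"
    by (rule card_Un_le)
  also have "\<dots> = card ?A + card ?B"
    by (simp add: card_image inj_on_def)
  finally show ?thesis .
qed

text \<open>The condition already fails at the full length, which is an admissible index because
  \<open>b \<noteq> 0\<close>.\<close>

lemma no_cute_ballots:
  assumes "real a < \<mu> * real b"
  shows "{xs \<in> ballots a b. cute \<mu> xs} = {}"
proof -
  have "\<not> cute \<mu> xs" if xs: "xs \<in> ballots a b" for xs
  proof
    assume "cute \<mu> xs"
    have "b \<noteq> 0" using assms by (intro notI) simp
    then have "length xs \<in> {1..length xs}" using length_ballots[OF xs] by simp
    with \<open>cute \<mu> xs\<close> have "\<mu> * real (count_list xs VoteB) \<le> real (count_list xs VoteA)"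
      unfolding cute_def by fastforce
    with xs assms show False by (simp add: ballots_def)
  qed
  then show ?thesis by blast
qed

lemma Suc_times_binomial_add: "Suc a * ((a + b) choose Suc a) = b * ((a + b) choose a)"
  using binomial_absorption[of a "a + b"] binomial_absorb_comp[of "a + b" a] by simp

text \<open>The left form obeys Pascal's rule; the right form shows the sign and yields the
  probability bound on division.\<close>

lemma binomial_diff_eq:
  "real ((a + b) choose a) - \<mu> * real ((a + b) choose Suc a)
    = (real a + 1 - \<mu> * real b) / (real a + 1) * real ((a + b) choose a)"
proof -
  have "(real a + 1) * real ((a + b) choose Suc a) = real b * real ((a + b) choose a)"
    using arg_cong[OF Suc_times_binomial_add[of a b], of real] by (simp add: algebra_simps)
  then have "real ((a + b) choose Suc a) = real b * real ((a + b) choose a) / (real a + 1)"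
    by (simp add: field_simps)
  then show ?thesis by (simp add: field_simps)
qed

text \<open>The bound \<open>a + 1\<close> instead of \<open>a\<close> makes the induction work: it
  admits the boundary strip \<open>a < \<mu> b \<le> a + 1\<close>, where the count is 0 and the
  right side is nonnegative.\<close>

lemma card_cute_le:
  assumes "\<mu> > 0" and "\<mu> * real b \<le> real a + 1"
  shows "real (card {xs \<in> ballots a b. cute \<mu> xs})
    \<le> real ((a + b) choose a) - \<mu> * real ((a + b) choose Suc a)"
  using assms(2)
proof (induction "a + b" arbitrary: a b rule: less_induct)
  case less
  show ?case
  proof (cases "real a < \<mu> * real b")
    case True
    then show ?thesis
      using less.prems by (simp add: no_cute_ballots binomial_diff_eq)
  next
    case False
    show ?thesis
    proof (cases b)
      case 0
      have "card {xs \<in> ballots a b. cute \<mu> xs} \<le> card (ballots a b)"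
        by (intro card_mono) (auto simp: finite_ballots)
      then show ?thesis using 0 by (simp add: card_ballots binomial_eq_0)
    next
      case b: (Suc b')
      have "0 < \<mu> * real b" using b \<open>\<mu> > 0\<close> by simp
      then have "a \<noteq> 0" using False by (intro notI) simp
      then obtain a' where a: "a = Suc a'" by (cases a) auto
      \<comment> \<open>The negated case \<open>\<mu> b \<le> a = a' + 1\<close> is exactly the
        hypothesis at \<open>(a', b)\<close>.\<close>
      have 1: "real (card {xs \<in> ballots a' b. cute \<mu> xs})
          \<le> real ((a' + b) choose a') - \<mu> * real ((a' + b) choose Suc a')"
        using False a by (intro less.hyps) simp_all
      have "\<mu> * real b' \<le> \<mu> * real b" using b \<open>\<mu> > 0\<close> by simp
      then have 2: "real (card {xs \<in> ballots a b'. cute \<mu> xs})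
          \<le> real ((a + b') choose a) - \<mu> * real ((a + b') choose Suc a)"
        using False b by (intro less.hyps) simp_all
      have "real (card {xs \<in> ballots a b. cute \<mu> xs})
          \<le> real (card {xs \<in> ballots a' b. cute \<mu> xs}) + real (card {xs \<in> ballots a b'. cute \<mu> xs})"
        using card_cute_Suc_Suc_le[of a' b' \<mu>] a b by simp
      \<comment> \<open>Pascal's rule applies to both binomial coefficients.\<close>
      with 1 2 show ?thesis unfolding a b by (simp add: algebra_simps)
    qed
  qed
qed

lemma cute_prob_upper:
  assumes "\<mu> > 0" and "\<mu> * real b \<le> real a + 1"
  shows "cute_prob \<mu> a b \<le> (real a + 1 - \<mu> * real b) / (real a + 1)"
proof -
  have "real ((a + b) choose a) > 0" by simp
  then show ?thesis
    using card_cute_le[OF assms] unfolding cute_prob_eq card_ballots binomial_diff_eq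
    by (simp add: pos_divide_le_eq)
qed

text \<open>The lower bound is restricted to \<open>b \<ge> 1\<close>: for \<open>b = 0\<close> its
  left side is \<open>(a + 1) / a\<close>, which exceeds 1.\<close>

theorem theorem2:
  fixes a b :: nat and \<mu> :: real
  assumes "a + b \<ge> 1" and "\<mu> > 0" and "real a \<ge> \<mu> * real b"
  shows "(b \<ge> 1 \<longrightarrow> real_of_int \<lfloor>real a - \<mu> * real b + 1\<rfloor> / real (a + b) \<le> cute_prob \<mu> a b)
    \<and> cute_prob \<mu> a b \<le> (real a + 1 - \<mu> * real b) / (real a + 1)"
  using assms cute_prob_lower cute_prob_upper by simp

end
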